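(* Let $m\ge2$, $\rho\ge\frac{m^m}{(m-1)^{m-1}}$ and $T>0$. Let $k_0$ be the largest $k$ for which $X_0^{(k)}$ is feasible for $P_m^{(k)}$, and $k_B$ the smallest $k$ for which $X_B^{(k)}$ is feasible for $P_m^{(k)}$. Then $X_0^{(k)}$ is feasible for $P_m^{(k)}$ if and only if $k\le k_0$, and $X_B^{(k)}$ is feasible for $P_m^{(k)}$ if and only if $k\ge k_B$. Moreover, $X_0^{(k_0)}$ is optimal for $\mathcal X_0$ and $X_B^{(k_B)}$ is optimal for $\mathcal X_B$ (i.e., each has objective value at least that of every point of the respective set).
   Context: For $k\ge m$, $P_m^{(k)}$ is the linear program in real variables $x_1,\dots,x_k$: maximize $\sum_{i=0}^{m-1}x_{k-i}$ subject to $(C_0)$: $\sum_{i=1}^{m-1}x_i\le\rho$; $(C_j)$: $\sum_{i=1}^{j+m-1}x_i\le\rho\,x_j$ for $j\in[1,k-m]$; $(E_j)$: $\sum_{i=1}^k x_i\le\rho\,x_j$ for $j\in[k-m+1,k-1]$; $(M_i)$: $x_i\le x_{i+1}$ for $i\in[1,k-1]$; $(B)$: $2\sum_{i=1}^{k-1}x_i+x_k\le T$. The objective value of a point of $\mathbb R^k$ is the sum of its last $m$ coordinates. $\Delta_m^{(k)}\subset\mathbb R^k$ is the line of points satisfying all of $(C_1),\dots,(C_{k-m}),(E_{k-m+1}),\dots,(E_{k-1})$ with equality; $X_0^{(k)}$ is the point of $\Delta_m^{(k)}$ satisfying $(C_0)$ with equality, and $X_B^{(k)}$ the point of $\Delta_m^{(k)}$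 satisfying $(B)$ with equality. $\mathcal X_0$ is the set of all $X_0^{(k)}$ that are feasible for $P_m^{(k)}$, and $\mathcal X_B$ the set of all $X_B^{(k)}$ that are feasible for $P_m^{(k)}$. These model $(1+2\rho)$-competitive cyclic search on an $m$-ray star with time budget $T$. *)

theory Defs
  imports "HOL-Analysis.Analysis"
begin

text \<open>
  Since k varies, a point of real k-space with coordinates numbered 1 to k is an element of
  the function space \<open>pt k\<close>. Extensionality (a fixed value outside 1 to k) makes this
  representation unique, so that the definite descriptions below are meaningful.
\<close>

definition pt :: "nat \<Rightarrow> (nat \<Rightarrow> real) set" where
  "pt k = ({1..k} \<rightarrow>\<^sub>E UNIV)"

definition feasible :: "nat \<Rightarrow> real \<Rightarrow> real \<Rightarrow> nat \<Rightarrow> (nat \<Rightarrow> real) set" where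
  "feasible m \<rho> T k = {x \<in> pt k.
      (\<Sum>i=1..m-1. x i) \<le> \<rho> \<and>
      (\<forall>j\<in>{1..k-m}. (\<Sum>i=1..j+m-1. x i) \<le> \<rho> * x j) \<and>
      (\<forall>j\<in>{k-m+1..k-1}. (\<Sum>i=1..k. x i) \<le> \<rho> * x j) \<and>
      (\<forall>i\<in>{1..k-1}. x i \<le> x (i+1)) \<and>
      2 * (\<Sum>i=1..k-1. x i) + x k \<le> T}"

definition Delta :: "nat \<Rightarrow> real \<Rightarrow> nat \<Rightarrow> (nat \<Rightarrow> real) set" where
  "Delta m \<rho> k = {x \<in> pt k.
      (\<forall>j\<in>{1..k-m}. (\<Sum>i=1..j+m-1. x i) = \<rho> * x j) \<and>
      (\<forall>j\<in>{k-m+1..k-1}. (\<Sum>i=1..k. x i) = \<rho> * x j)}"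

definition X0 :: "nat \<Rightarrow> real \<Rightarrow> nat \<Rightarrow> (nat \<Rightarrow> real)" where
  "X0 m \<rho> k = (THE x. x \<in> Delta m \<rho> k \<and> (\<Sum>i=1..m-1. x i) = \<rho>)"

definition XB :: "nat \<Rightarrow> real \<Rightarrow> real \<Rightarrow> nat \<Rightarrow> (nat \<Rightarrow> real)" where
  "XB m \<rho> T k = (THE x. x \<in> Delta m \<rho> k \<and> 2 * (\<Sum>i=1..k-1. x i) + x k = T)"

text \<open>
  The points compared with each other live in spaces of different dimensions, so each one is
  paired with its dimension. All subtractions of naturals are exact because \<open>k \<ge> m \<ge> 2\<close>.
\<close>

fun objective :: "nat \<Rightarrow> nat \<times> (nat \<Rightarrow> real) \<Rightarrow> real" where
  "objective m (k, x) = (\<Sum>i=0..m-1. x (k - i))"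

definition set_X0 :: "nat \<Rightarrow> real \<Rightarrow> real \<Rightarrow> (nat \<times> (nat \<Rightarrow> real)) set" where
  "set_X0 m \<rho> T = {(k, X0 m \<rho> k) | k. m \<le> k \<and> X0 m \<rho> k \<in> feasible m \<rho> T k}"

definition set_XB :: "nat \<Rightarrow> real \<Rightarrow> real \<Rightarrow> (nat \<times> (nat \<Rightarrow> real)) set" where
  "set_XB m \<rho> T = {(k, XB m \<rho> T k) | k. m \<le> k \<and> XB m \<rho> T k \<in> feasible m \<rho> T k}"

definition optimal_for ::
    "nat \<Rightarrow> nat \<times> (nat \<Rightarrow> real) \<Rightarrow> (nat \<times> (nat \<Rightarrow> real)) set \<Rightarrow> bool" where
  "optimal_for m p S \<longleftrightarrow> p \<in> S \<and> (\<forall>q\<in>S. objective m q \<le> objective m p)"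

text \<open>
  For small T no \<open>X0 m \<rho> k\<close> with \<open>k \<ge> m\<close> is feasible, so an index \<open>k0\<close> as below need not exist.
\<close>

definition is_k0 :: "nat \<Rightarrow> real \<Rightarrow> real \<Rightarrow> nat \<Rightarrow> bool" where
  "is_k0 m \<rho> T k0 \<longleftrightarrow> m \<le> k0 \<and> X0 m \<rho> k0 \<in> feasible m \<rho> T k0 \<and>
     (\<forall>k\<ge>m. X0 m \<rho> k \<in> feasible m \<rho> T k \<longrightarrow> k \<le> k0)"

definition is_kB :: "nat \<Rightarrow> real \<Rightarrow> real \<Rightarrow> nat \<Rightarrow> bool" where
  "is_kB m \<rho> T kB \<longleftrightarrow> m \<le> kB \<and> XB m \<rho> T kB \<in> feasible m \<rho> T kB \<and>
     (\<forall>k\<ge>m. XB m \<rho> T k \<in> feasible m \<rho> T k \<longrightarrow> kB \<le> k)"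

end

theory Submission
  imports Defs
begin

text \<open>
  Subtracting consecutive constraints, a point of the line satisfies
  \<open>x j = x (j + 1) - x (j + m) / \<rho>\<close>, so read from the last coordinate backwards it is a combination
  of two shifts of one solution \<open>g\<close> of the delay recurrence \<open>g n = g (n - 1) - g (n - m) / \<rho>\<close>.
  The bound on \<open>\<rho>\<close> is exactly what keeps \<open>g\<close> positive, with consecutive quotients at least
  \<open>r = (m - 1) / m\<close>, and then \<open>w n = g n / g (n + m - 1)\<close> is increasing. This makes the direction
  \<open>ray k\<close> of the line positive and monotone, so that \<open>X0\<close> is feasible iff it satisfies (B), and
  \<open>XB\<close> iff it satisfies (C0); both say on which side of \<open>T\<close> the number
  \<open>(2 * \<rho> - ray k k) / ray k 0\<close> lies. It is monotone and unbounded in \<open>k\<close>, since \<open>ray k k\<close> and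
  \<open>ray k 0\<close> decrease and the latter tends to 0. The objective values are
  \<open>(ray k k + m - 1) / ray k 0\<close> for \<open>X0\<close> and \<open>T * (ray k k + m - 1) / (2 * \<rho> - ray k k)\<close> for \<open>XB\<close>.
  The second clearly decreases; the first increases because \<open>ray k k / ray k 0\<close> does, which amounts
  to a quadratic inequality between \<open>w j\<close> and its values \<open>m - 1\<close> steps before and after.
\<close>

text \<open>The index is shifted by \<open>m - 1\<close> so that the initial zeros sit at natural numbers; the disjunct
  \<open>m = 0\<close> only serves termination.\<close>

fun delay_seq :: "nat \<Rightarrow> real \<Rightarrow> nat \<Rightarrow> real" where
  "delay_seq m \<rho> n = (if n < m - 1 then 0 else if n = m - 1 \<or> m = 0 then 1
             else delay_seq m \<rho> (n - 1) - delay_seq m \<rho> (n - m) / \<rho>)"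

declare delay_seq.simps [simp del]

definition delay_quot :: "nat \<Rightarrow> real \<Rightarrow> nat \<Rightarrow> real" where
  "delay_quot m \<rho> n = delay_seq m \<rho> n / delay_seq m \<rho> (n + m - 1)"

section \<open>The delay recurrence: positivity and bounded decay of its solution\<close>

locale cyclic_search =
  fixes m :: nat and \<rho> :: real
  assumes m_ge_2: "m \<ge> 2"
    and rho_ge: "\<rho> \<ge> real m ^ m / real (m - 1) ^ (m - 1)"
begin

abbreviation g :: "nat \<Rightarrow> real" where "g \<equiv> delay_seq m \<rho>"

abbreviation w :: "nat \<Rightarrow> real" where "w \<equiv> delay_quot m \<rho>"

text \<open>At the smallest admissible \<open>\<rho>\<close> this is the double root of the
  characteristic equation \<open>z ^ (m - 1) * (1 - z) = 1 / \<rho>\<close> of the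
  recurrence.\<close>

definition r :: real where "r = (real m - 1) / real m"

definition E :: real where "E = (1 / r) ^ (m - 1)"

lemma r_bounds: "0 < r" "r < 1"
  using m_ge_2 by (auto simp: r_def)

lemma E_ge_1: "1 \<le> E"
  unfolding E_def using r_bounds by (intro one_le_power) auto

text \<open>The lower bound on \<open>\<rho>\<close> is the number \<open>m * E\<close>.
  Equivalently \<open>1 / \<rho> \<le> r ^ (m - 1) * (1 - r)\<close>, which is what drives the
  induction in \<open>g_ratio\<close>.\<close>

lemma rho_ge_E: "real m * E \<le> \<rho>"
proof -
  have "real m ^ m = real m * real m ^ (m - 1)"
    using m_ge_2 by (metis Suc_diff_1 less_le_trans pos2 power_Suc)
  then have "real m * E = real m ^ m / real (m - 1) ^ (m - 1)"
    using m_ge_2 by (simp add: E_def r_def power_divide of_nat_diff)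
  with rho_ge show ?thesis by simp
qed

lemma rho_gt_E: "E < \<rho>"
proof -
  have "E * 2 \<le> E * real m" using m_ge_2 E_ge_1 by (intro mult_left_mono) auto
  then show ?thesis using rho_ge_E E_ge_1 mult.commute[of E "real m"] by linarith
qed

lemma rho_pos: "0 < \<rho>"
  using rho_gt_E E_ge_1 by linarith

lemma m_diff_le [simp]: "m - Suc 0 \<le> n + m - Suc 0"
  by simp

lemma g_eq_0: "n < m - 1 \<Longrightarrow> g n = 0"
  by (simp add: delay_seq.simps)

lemma g_eq_1_first: "g (m - Suc 0) = 1"
  by (simp add: delay_seq.simps)

lemma g_rec: "m \<le> n \<Longrightarrow> g n = g (n - 1) - g (n - m) / \<rho>"
  using m_ge_2 by (subst delay_seq.simps) auto

text \<open>The delayed term is still one of the initial zeros, so \<open>g\<close> stays constant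
  on a block of \<open>m\<close> indices. This block yields the equal coordinates in
  \<open>ray_eq_1\<close>.\<close>

lemma g_eq_1: "n < m \<Longrightarrow> g (n + m - 1) = 1"
proof (induction n)
  case 0
  then show ?case by (simp add: g_eq_1_first)
next
  case (Suc n)
  have "g (Suc n + m - 1) = g (n + m - 1) - g n / \<rho>"
    using m_ge_2 by (subst g_rec) (auto simp: algebra_simps)
  with Suc show ?case by (simp add: g_eq_0)
qed

text \<open>The quotient bound reproduces itself: over \<open>m - 1\<close> steps it gives
  \<open>g a \<le> E * g n\<close>, so the delayed term \<open>g a / \<rho>\<close> takes away at
  most the share \<open>1 / m\<close> of \<open>g n\<close> and leaves
  \<open>r * g n\<close>.\<close>

lemma g_ratio:
  assumes "m - 1 \<le> n"
  shows "0 < g n \<and> r * g n \<le> g (Suc n)"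
  using assms
proof (induction n rule: less_induct)
  case (less n)
  have pos: "0 < g n"
  proof (cases "n = m - 1")
    case True
    then show ?thesis by (simp add: g_eq_1_first)
  next
    case False
    with less.prems have "m - 1 \<le> n - 1" "n - 1 < n" "Suc (n - 1) = n" by auto
    with less.IH[of "n - 1"] have "0 < g (n - 1)" "r * g (n - 1) \<le> g n" by auto
    with r_bounds show ?thesis by (smt (verit) mult_pos_pos)
  qed
  define a where "a = Suc n - m"
  have an: "a + (m - 1) = n" using less.prems m_ge_2 by (simp add: a_def)
  have rec: "g (Suc n) = g n - g a / \<rho>"
    using less.prems m_ge_2 by (subst g_rec) (auto simp: a_def)
  have "g a \<le> E * g n"
  proof (cases "a < m - 1")
    case True
    then show ?thesis using pos E_ge_1 by (simp add: g_eq_0)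
  next
    case False
    have "r ^ i * g a \<le> g (a + i)" if "i \<le> m - 1" for i
      using that
    proof (induction i)
      case (Suc i)
      have "a + i < n" using an Suc.prems by linarith
      then have "r * g (a + i) \<le> g (Suc (a + i))" using less.IH[of "a + i"] False by auto
      moreover have "r * (r ^ i * g a) \<le> r * g (a + i)"
        using Suc r_bounds by (intro mult_left_mono) auto
      ultimately show ?case by (simp add: mult.assoc)
    qed simp
    then have "r ^ (m - 1) * g a \<le> g n" using an by auto
    then have "E * (r ^ (m - 1) * g a) \<le> E * g n"
      using E_ge_1 by (intro mult_left_mono) auto
    moreover have "E * r ^ (m - 1) = 1"
      using r_bounds by (simp add: E_def power_divide)
    ultimately show ?thesis by (simp add: mult.assoc[symmetric])
  qed
  also have "\<dots> \<le> \<rho> / real m * g n"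
    using rho_ge_E m_ge_2 pos by (intro mult_right_mono) (auto simp: field_simps)
  finally have "g a / \<rho> \<le> g n / real m"
    using rho_pos by (simp add: field_simps)
  then have "r * g n \<le> g (Suc n)"
    using m_ge_2 unfolding rec r_def by (simp add: field_simps)
  with pos show ?case by simp
qed

lemma g_pos: "m - 1 \<le> n \<Longrightarrow> 0 < g n"
  using g_ratio by blast

lemma g_nonneg: "0 \<le> g n"
  using g_pos[of n] g_eq_0[of n] by (cases "m - 1 \<le> n") auto

lemma g_Suc_ge: "m - 1 \<le> n \<Longrightarrow> r * g n \<le> g (Suc n)"
  using g_ratio by blast

lemma g_Suc_le:
  assumes "m - 1 \<le> n"
  shows "g (Suc n) \<le> g n"
proof -
  have "g (Suc n) = g n - g (Suc n - m) / \<rho>"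
    using assms m_ge_2 by (subst g_rec) auto
  moreover have "0 \<le> g (Suc n - m) / \<rho>" using g_nonneg rho_pos by simp
  ultimately show ?thesis by linarith
qed

lemma g_antimono:
  assumes "m - 1 \<le> a"
  shows "g (a + i) \<le> g a"
proof (induction i)
  case (Suc i)
  then show ?case using g_Suc_le[of "a + i"] assms by simp
qed simp

lemma g_power_le:
  assumes "m - 1 \<le> a"
  shows "r ^ i * g a \<le> g (a + i)"
proof (induction i)
  case (Suc i)
  have "r * (r ^ i * g a) \<le> r * g (a + i)"
    using Suc r_bounds by (intro mult_left_mono) auto
  also have "\<dots> \<le> g (Suc (a + i))" using g_Suc_ge assms by auto
  finally show ?case by (simp add: mult.assoc)
qed simp

section \<open>The quotients \<open>w\<close> and their growth\<close>

lemma g_shift_pos: "0 < g (n + m - 1)"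
  by (rule g_pos) simp

lemma g_eq_w_mult: "g n = w n * g (n + m - 1)"
  using g_shift_pos[of n] by (simp add: delay_quot_def)

text \<open>The delayed value is \<open>w n\<close> times the current one, so
  \<open>w n / \<rho>\<close> is the relative loss in one step. This turns the linear recurrence for
  \<open>g\<close> into one for \<open>w\<close> alone.\<close>

lemma g_step: "g (n + m) = g (n + m - 1) * (1 - w n / \<rho>)"
  using g_rec[of "n + m"] g_eq_w_mult[of n] m_ge_2 by (simp add: algebra_simps)

lemma w_nonneg: "0 \<le> w n"
  using g_nonneg by (simp add: delay_quot_def)

lemma w_eq_0: "n < m - 1 \<Longrightarrow> w n = 0"
  by (simp add: delay_quot_def g_eq_0)

lemma w_eq_1: "w (m - 1) = 1"
  using g_eq_1[of "m - 1"] m_ge_2 unfolding delay_quot_def by (simp add: g_eq_1_first)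

lemma w_le_E: "w n \<le> E"
proof (cases "n < m - 1")
  case True
  then show ?thesis using E_ge_1 by (simp add: w_eq_0)
next
  case False
  have "E * (r ^ (m - 1) * g n) \<le> E * g (n + m - 1)"
    using g_power_le[of n "m - 1"] False E_ge_1 m_ge_2 by (intro mult_left_mono) auto
  moreover have "E * r ^ (m - 1) = 1"
    using r_bounds by (simp add: E_def power_divide)
  ultimately have "g n \<le> E * g (n + m - 1)" by (simp add: mult.assoc[symmetric])
  then show ?thesis using g_shift_pos[of n] by (simp add: delay_quot_def pos_divide_le_eq)
qed

lemma ratio_ge: "r \<le> 1 - w n / \<rho>"
proof -
  have "r * g (n + m - 1) \<le> g (n + m)"
    using g_Suc_ge[of "n + m - 1"] m_ge_2 by simp
  then show ?thesis
    using g_shift_pos[of n] by (simp add: g_step mult.commute)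
qed

lemma ratio_pos: "0 < 1 - w n / \<rho>"
  using ratio_ge[of n] r_bounds by linarith

text \<open>Numerator and denominator of \<open>w\<close> both advance by \<open>g_step\<close>, at
  indices \<open>m - 1\<close> apart.\<close>

lemma w_Suc:
  assumes "m - 1 \<le> n"
  shows "w (Suc n) * (1 - w n / \<rho>) = w n * (1 - w (Suc n - m) / \<rho>)"
proof -
  have n: "Suc n - m + m = Suc n" using assms m_ge_2 by auto
  have *: "g (Suc n) = g n * (1 - w (Suc n - m) / \<rho>)"
    using g_step[of "Suc n - m"] unfolding n by simp
  have "w (Suc n) = g (Suc n) / (g (n + m - 1) * (1 - w n / \<rho>))"
    using g_step[of n] by (simp add: delay_quot_def)
  also have "g (Suc n) = g (n + m - 1) * (w n * (1 - w (Suc n - m) / \<rho>))"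
    using * g_eq_w_mult[of n] by (simp add: mult_ac)
  finally show ?thesis
    using less_imp_neq[OF ratio_pos[of n]] less_imp_neq[OF g_shift_pos[of n]]
    by (simp add: eq_divide_eq)
qed

lemma w_diff:
  assumes "m - 1 \<le> n"
  shows "w (Suc n) - w n = w n / (\<rho> - w n) * (w n - w (Suc n - m))"
proof -
  have pos: "0 < \<rho> - w n" using w_le_E[of n] rho_gt_E by linarith
  have "w (Suc n) * (\<rho> - w n) = w n * (\<rho> - w (Suc n - m))"
    using w_Suc[OF assms] rho_pos by (simp add: field_simps)
  then show ?thesis using pos by (simp add: field_simps)
qed

text \<open>By \<open>w_diff\<close> the increment is a nonnegative multiple of
  \<open>w n - w (Suc n - m)\<close>, so monotonicity up to \<open>n\<close> extends by one step.
  Before index \<open>m - 1\<close> all values are 0.\<close>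

lemma w_Suc_ge: "w n \<le> w (Suc n)"
proof (induction n rule: less_induct)
  case (less n)
  show ?case
  proof (cases "n < m - 1")
    case True
    then show ?thesis using w_nonneg by (simp add: w_eq_0)
  next
    case False
    have "w (Suc n - m) \<le> w (Suc n - m + i)" if "Suc n - m + i \<le> n" for i
      using that
    proof (induction i)
      case (Suc i)
      then show ?case using less.IH[of "Suc n - m + i"] by simp
    qed simp
    from this[of "m - 1"] have "w (Suc n - m) \<le> w n" using False m_ge_2 by simp
    moreover have "0 \<le> w n / (\<rho> - w n)"
      using w_nonneg[of n] w_le_E[of n] rho_gt_E by simp
    ultimately have "0 \<le> w n / (\<rho> - w n) * (w n - w (Suc n - m))"
      by (intro mult_nonneg_nonneg) auto
    then show ?thesis using w_diff[of n] False by simp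
  qed
qed

lemma w_mono: "i \<le> j \<Longrightarrow> w i \<le> w j"
  using lift_Suc_mono_le[of w] w_Suc_ge by blast

lemma w_ge_1: "m - 1 \<le> n \<Longrightarrow> 1 \<le> w n"
  using w_mono[of "m - 1" n] w_eq_1 by simp

text \<open>Strictness starts with the jump from 0 to 1 between \<open>m - 2\<close> and
  \<open>m - 1\<close>, and \<open>w_diff\<close> passes it on. It is what makes
  \<open>ray k 0\<close> positive.\<close>

lemma w_strict_Suc: "m - 2 \<le> n \<Longrightarrow> w n < w (Suc n)"
proof (induction n)
  case 0
  then have "m = 2" using m_ge_2 by simp
  then show ?case using w_eq_0[of 0] w_eq_1 by simp
next
  case (Suc n)
  show ?case
  proof (cases "m - 2 \<le> n")
    case True
    have "w (Suc (Suc n) - m) \<le> w n" using m_ge_2 by (intro w_mono) auto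
    also have "\<dots> < w (Suc n)" using Suc True by simp
    finally have "0 < w (Suc n) - w (Suc (Suc n) - m)" by simp
    moreover have "0 < w (Suc n) / (\<rho> - w (Suc n))"
      using w_ge_1[of "Suc n"] w_le_E[of "Suc n"] rho_gt_E True m_ge_2
      by (intro divide_pos_pos) linarith+
    ultimately have "0 < w (Suc n) / (\<rho> - w (Suc n)) * (w (Suc n) - w (Suc (Suc n) - m))"
      by (intro mult_pos_pos)
    moreover have "m - 1 \<le> Suc n" using True m_ge_2 by simp
    ultimately show ?thesis using w_diff[of "Suc n"] by simp
  next
    case False
    then have "Suc n = m - 2" using Suc.prems by simp
    then have "w (Suc n) = 0" "Suc (Suc n) = m - 1" using w_eq_0 m_ge_2 by auto
    then show ?thesis using w_eq_1 by simp
  qed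
qed

lemma w_strict: "m - 2 \<le> i \<Longrightarrow> i < j \<Longrightarrow> w i < w j"
  using w_strict_Suc[of i] w_mono[of "Suc i" j] by simp

section \<open>The quadratic inequality for \<open>w\<close>\<close>

text \<open>One step enlarges the distance to the base point \<open>w (Suc j - m)\<close> at most by the factor
  \<open>1 + 1 / (m - 1) = 1 / r\<close>, and \<open>E\<close> is that factor to the power \<open>m - 1\<close>.\<close>

lemma w_block_increment_le:
  assumes "m - 1 \<le> j"
  shows "w (j + m - 1) - w j \<le> (E - 1) * (w j - w (Suc j - m))"
proof -
  define p where "p = Suc j - m"
  have growth: "w (j + i) - w p \<le> (w j - w p) * (1 / r) ^ i" for i
  proof (induction i)
    case (Suc i)
    have th: "w (j + i) / (\<rho> - w (j + i)) \<le> 1 / (real m - 1)"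
    proof -
      have "real m * w (j + i) \<le> real m * E" using w_le_E by (intro mult_left_mono) auto
      also have "\<dots> \<le> \<rho>" by (rule rho_ge_E)
      finally have "w (j + i) * (real m - 1) \<le> \<rho> - w (j + i)" by (simp add: algebra_simps)
      then show ?thesis using w_le_E[of "j + i"] rho_gt_E m_ge_2 by (simp add: field_simps)
    qed
    have p_le: "w p \<le> w (Suc (j + i) - m)" by (rule w_mono) (simp add: p_def)
    have le: "w (Suc (j + i) - m) \<le> w (j + i)" using m_ge_2 by (intro w_mono) auto
    have "w (Suc (j + i)) - w (j + i) \<le> 1 / (real m - 1) * (w (j + i) - w p)"
      unfolding w_diff[OF trans_le_add1[OF assms]]
      using th p_le le m_ge_2 by (intro mult_mono) auto
    then have "w (Suc (j + i)) - w p \<le> (1 + 1 / (real m - 1)) * (w (j + i) - w p)"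
      by (simp add: algebra_simps)
    also have "1 + 1 / (real m - 1) = 1 / r" using m_ge_2 by (simp add: r_def field_simps)
    also have "1 / r * (w (j + i) - w p) \<le> 1 / r * ((w j - w p) * (1 / r) ^ i)"
      using Suc r_bounds by (intro mult_left_mono) auto
    finally show ?case by (simp add: mult.left_commute)
  qed simp
  have "w (j + m - 1) - w p \<le> (w j - w p) * E"
    using growth[of "m - 1"] m_ge_2 by (simp add: E_def)
  then show ?thesis by (simp add: p_def algebra_simps)
qed

text \<open>If \<open>w j\<close> is large, \<open>w_le_E\<close> suffices. Otherwise a linear lower
  bound for \<open>g\<close> over the block bounds the later value of \<open>w\<close> by
  \<open>E / (E - r * w j)\<close>.\<close>

lemma w_block_ratio_le:
  assumes "m - 1 \<le> j"
  shows "w (j + m - 1) * (E - r) \<le> w j * E"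
proof (cases "E - r \<le> w j")
  case True
  have "w (j + m - 1) * (E - r) \<le> E * w j"
    using True w_le_E[of "j + m - 1"] E_ge_1 r_bounds w_nonneg by (intro mult_mono) auto
  then show ?thesis by (simp add: mult.commute)
next
  case False
  let ?v = "w j" and ?u = "w (j + m - 1)" and ?a = "g (j + m - 1)"
  \<comment> \<open>Each step subtracts some \<open>g (j + i) / \<rho>\<close>, which is at most
    \<open>g j / \<rho>\<close>.\<close>
  have lower: "?a - real i * (g j / \<rho>) \<le> g (j + m - 1 + i)" for i
  proof (induction i)
    case (Suc i)
    have "g (j + m - 1 + Suc i) = g (j + m - 1 + i) - g (j + i) / \<rho>"
      using m_ge_2 by (subst g_rec) (auto simp: algebra_simps)
    moreover have "g (j + i) / \<rho> \<le> g j / \<rho>"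
      using g_antimono[OF assms] rho_pos by (intro divide_right_mono) auto
    ultimately show ?case using Suc by (simp add: algebra_simps add_divide_distrib)
  qed simp
  have a: "0 < ?a" by (rule g_shift_pos)
  have v1: "1 \<le> ?v" using w_ge_1 assms by simp
  have "1 \<le> ?u" by (rule w_ge_1) simp
  then have u: "0 < ?u" by linarith
  have "g (j + m - 1 + (m - 1)) * ?u = ?a"
    using g_eq_w_mult[of "j + m - 1"] m_ge_2 by (simp add: mult.commute)
  moreover have "g j = ?v * ?a" by (rule g_eq_w_mult)
  ultimately have "(?a - real (m - 1) * (?v * ?a / \<rho>)) * ?u \<le> ?a"
    using mult_right_mono[OF lower[of "m - 1"], of ?u] u by simp
  then have "?a * ((1 - real (m - 1) * ?v / \<rho>) * ?u) \<le> ?a * 1"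
    by (simp add: algebra_simps)
  then have 1: "(1 - real (m - 1) * ?v / \<rho>) * ?u \<le> 1"
    using a by (simp only: mult_le_cancel_left_pos)
  have "real (m - 1) / \<rho> \<le> real (m - 1) / (real m * E)"
    using rho_ge_E E_ge_1 m_ge_2 rho_pos by (intro divide_left_mono) auto
  also have "\<dots> = r / E" using m_ge_2 by (simp add: r_def)
  finally have "real (m - 1) / \<rho> * ?v \<le> r / E * ?v" using v1 by (intro mult_right_mono) auto
  then have "(1 - r / E * ?v) * ?u \<le> (1 - real (m - 1) * ?v / \<rho>) * ?u"
    using u by (intro mult_right_mono) auto
  with 1 have "(1 - r / E * ?v) * ?u \<le> 1" by linarith
  then have 2: "?u * (E - r * ?v) \<le> E" using E_ge_1 by (simp add: field_simps)
  \<comment> \<open>It remains to see \<open>E - r \<le> ?v * (E - r * ?v)\<close>. The difference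
    of the sides is quadratic with roots 1 and \<open>E / r - 1\<close>, and \<open>?v\<close> lies
    between them.\<close>
  have "r * (?v + 1) \<le> r * (E - r + 1)" using False r_bounds by (intro mult_left_mono) auto
  also have "\<dots> \<le> E"
  proof -
    have "r * (1 - r) \<le> E * (1 - r)" using r_bounds E_ge_1 by (intro mult_right_mono) auto
    then show ?thesis by (simp add: algebra_simps)
  qed
  finally have "0 \<le> (?v - 1) * (E - r * (?v + 1))" using v1 by simp
  then have "E - r \<le> ?v * (E - r * ?v)" by (simp add: algebra_simps)
  then have "?u * (E - r) \<le> ?u * (?v * (E - r * ?v))" using u by (intro mult_left_mono) auto
  also have "\<dots> = ?v * (?u * (E - r * ?v))" by simp
  also have "\<dots> \<le> ?v * E" using 2 v1 by (intro mult_left_mono) auto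
  finally show ?thesis .
qed

text \<open>Two bounds for the increment over a block are multiplied: one by the increment over the
  preceding block, with factor \<open>E - 1\<close>, and one by \<open>w j\<close>, with factor
  \<open>r / (E - r)\<close>. The product of the factors is at most \<open>r\<close>, and
  \<open>ratio_ge\<close> compares \<open>r\<close> with the last factor of the claim.\<close>

lemma w_increment_square_le:
  assumes "m - 1 \<le> j"
  shows "(w (j + m - 1) - w j)\<^sup>2
         \<le> (w j - w (Suc j - m)) * w j * (1 - w (j + m - 1) / \<rho>)"
proof -
  let ?X = "w j - w (Suc j - m)" and ?Y = "w (j + m - 1) - w j"
  have X: "0 \<le> ?X" using w_mono[of "Suc j - m" j] m_ge_2 by simp
  have Y: "0 \<le> ?Y" using w_mono[of j "j + m - 1"] m_ge_2 by simp
  have Er: "0 < E - r" "E - 1 \<le> E - r" using E_ge_1 r_bounds by auto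
  have "?Y * (E - r) \<le> w j * r" using w_block_ratio_le[OF assms] by (simp add: algebra_simps)
  then have "?Y * (?Y * (E - r)) \<le> (E - 1) * ?X * (w j * r)"
    using w_block_increment_le[OF assms] X Y Er(1) w_nonneg E_ge_1
    by (intro mult_mono[of ?Y "(E - 1) * ?X"] mult_nonneg_nonneg) auto
  also have "\<dots> \<le> (E - r) * ?X * (w j * r)"
    using X Er w_nonneg r_bounds by (intro mult_right_mono) auto
  finally have "?Y\<^sup>2 * (E - r) \<le> (?X * w j * r) * (E - r)"
    by (simp add: power2_eq_square algebra_simps)
  then have "?Y\<^sup>2 \<le> ?X * w j * r" using Er by simp
  also have "\<dots> \<le> ?X * w j * (1 - w (j + m - 1) / \<rho>)"
    using ratio_ge X w_nonneg by (intro mult_left_mono) auto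
  finally show ?thesis .
qed

section \<open>The direction of the line of tight constraints\<close>

text \<open>
  Coordinates are normalised to 1 just before the last one. At \<open>i = 0\<close>, outside the range of
  coordinates, \<open>ray k 0\<close> is the sum in (C0) divided by \<open>\<rho>\<close>.
\<close>

definition ray :: "nat \<Rightarrow> nat \<Rightarrow> real" where
  "ray k i = (if i = k then \<rho> / w (k + m - 2)
              else g (k - i + m - 2) - g (k - i - 1) / w (k + m - 2))"

definition ray_pt :: "real \<Rightarrow> nat \<Rightarrow> nat \<Rightarrow> real" where
  "ray_pt c k = (\<lambda>i\<in>{1..k}. c * ray k i)"

text \<open>The sum telescopes: \<open>g n\<close> equals \<open>\<rho>\<close> times the decrement from \<open>g (n + m - 1)\<close> to \<open>g (n + m)\<close>.\<close>

lemma partial_sum: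
  assumes "\<And>i. 1 \<le> i \<Longrightarrow> i < k \<Longrightarrow> x i = a * g (k - i + m - 2) - b * g (k - i - 1)"
    and "p < k"
  shows "(\<Sum>i=1..p. x i) = \<rho> * (a * (g (k - p + 2 * m - 3) - g (k + 2 * m - 3))
                                - b * (g (k - p + m - 2) - g (k + m - 2)))"
  using assms(2)
proof (induction p)
  case (Suc p)
  then have d: "k = p + 2 + (k - p - 2)" by simp
  define d where "d = k - p - 2"
  note d = d[folded d_def]
  have "d + 2 * m - 1 - 1 = d + 2 * m - 2" "d + 2 * m - 1 - m = d + m - 1" "m \<le> d + 2 * m - 1"
    using m_ge_2 by auto
  then have "g (d + 2 * m - 1) = g (d + 2 * m - 2) - g (d + m - 1) / \<rho>"
    using g_rec[of "d + 2 * m - 1"] by simp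
  moreover have "g (d + m) = g (d + m - 1) - g d / \<rho>"
    using g_rec[of "d + m"] by simp
  moreover have "x (Suc p) = a * g (d + m - 1) - b * g d"
    using assms(1)[of "Suc p"] Suc.prems d by (simp add: numeral_2_eq_2)
  moreover have idx: "k - Suc p + 2 * m - 3 = d + 2 * m - 2" "k - p + 2 * m - 3 = d + 2 * m - 1"
    "k - Suc p + m - 2 = d + m - 1" "k - p + m - 2 = d + m"
    using d m_ge_2 by auto
  moreover have "(\<Sum>i=1..p. x i) = \<rho> * (a * (g (d + 2 * m - 1) - g (k + 2 * m - 3))
                                - b * (g (d + m) - g (k + m - 2)))"
    using Suc idx by simp
  moreover have "(\<Sum>i=1..Suc p. x i) = (\<Sum>i=1..p. x i) + x (Suc p)" by simp
  ultimately show ?case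
    using rho_pos by (simp only:) (simp add: field_simps)
qed simp

lemma g_eq_w_mult_end: "1 \<le> k \<Longrightarrow> g (k + m - 2) = w (k + m - 2) * g (k + 2 * m - 3)"
proof -
  assume "1 \<le> k"
  then have "k + m - 2 + m - 1 = k + 2 * m - 3" using m_ge_2 by simp
  then show ?thesis using g_eq_w_mult[of "k + m - 2"] by simp
qed

lemma w_end_ge_1: "1 \<le> k \<Longrightarrow> 1 \<le> w (k + m - 2)"
  by (rule w_ge_1) auto

lemma g_double: "g (2 * m - 2) = 1"
  using g_eq_1[of "m - 1"] m_ge_2 by (simp add: numeral_eq_Suc)

text \<open>The coefficient \<open>1 / w (k + m - 2)\<close> in \<open>ray\<close> is the one for
  which the boundary terms of \<open>partial_sum\<close> that do not depend on \<open>p\<close>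
  cancel.\<close>

lemma sum_ray:
  assumes "p < k"
  shows "(\<Sum>i=1..p. ray k i) = \<rho> * (g (k - p + 2 * m - 3) - g (k - p + m - 2) / w (k + m - 2))"
proof -
  have "1 \<le> k" using assms by simp
  note g_eq_w_mult_end[OF this] w_end_ge_1[OF this]
  moreover have "(\<Sum>i=1..p. ray k i) = \<rho> * (1 * (g (k - p + 2 * m - 3) - g (k + 2 * m - 3))
      - (1 / w (k + m - 2)) * (g (k - p + m - 2) - g (k + m - 2)))"
    by (rule partial_sum[OF _ assms]) (simp add: ray_def)
  ultimately show ?thesis by (simp add: field_simps)
qed

lemma sum_ray_total:
  assumes "1 \<le> k"
  shows "(\<Sum>i=1..k. ray k i) = \<rho>"
proof -
  have "(\<Sum>i=1..k. ray k i) = (\<Sum>i=1..k - 1. ray k i) + ray k k"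
    using assms by (cases k) auto
  also have "(\<Sum>i=1..k - 1. ray k i) = \<rho> * (g (2 * m - 2) - g (m - 1) / w (k + m - 2))"
    using sum_ray[of "k - 1" k] assms m_ge_2 by (simp add: numeral_eq_Suc)
  also have "\<dots> + ray k k = \<rho>"
    unfolding g_double by (simp add: ray_def g_eq_1_first algebra_simps)
  finally show ?thesis .
qed

text \<open>The case \<open>j = 0\<close> is included to evaluate (C0); the others are the
  constraints (C_j).\<close>

lemma sum_ray_head:
  assumes "m \<le> k" "j \<le> k - m"
  shows "(\<Sum>i=1..j + m - 1. ray k i) = \<rho> * ray k j"
proof -
  have "k - (j + m - 1) + 2 * m - 3 = k - j + m - 2" "k - (j + m - 1) + m - 2 = k - j - 1"
    "j + m - 1 < k" "j \<noteq> k"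
    using assms m_ge_2 by auto
  then show ?thesis using sum_ray[of "j + m - 1" k] by (simp only: ray_def if_False)
qed

lemma ray_eq_1:
  assumes "k - m < i" "i < k"
  shows "ray k i = 1"
proof -
  have "g (k - i + m - 2) = 1"
    using g_eq_1[of "k - i - 1"] assms m_ge_2 by (simp add: numeral_2_eq_2 Suc_diff_Suc)
  moreover have "g (k - i - 1) = 0" using assms by (intro g_eq_0) auto
  ultimately show ?thesis using assms by (simp add: ray_def)
qed

text \<open>In this factored form the sign can be read off from the monotonicity of
  \<open>w\<close>.\<close>

lemma ray_eq:
  assumes "i < k"
  shows "ray k i = g (k - i + m - 2) * (1 - w (k - i - 1) / w (k + m - 2))"
proof -
  have "k - i + m - 2 = (k - i - 1) + m - 1" using assms m_ge_2 by simp
  then show ?thesis using g_eq_w_mult[of "k - i - 1"] assms by (simp add: ray_def algebra_simps)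
qed

lemma ray_nonneg:
  assumes "i \<le> k" "1 \<le> k"
  shows "0 \<le> ray k i"
proof (cases "i = k")
  case True
  then show ?thesis using rho_pos w_nonneg by (simp add: ray_def)
next
  case False
  have "w (k - i - 1) \<le> w (k + m - 2)" by (rule w_mono) (use m_ge_2 in auto)
  then have "w (k - i - 1) / w (k + m - 2) \<le> 1" using w_end_ge_1[of k] assms by simp
  then show ?thesis using False assms g_nonneg by (simp add: ray_eq)
qed

lemma ray_diff:
  assumes "1 \<le> j" "j + m \<le> k"
  shows "\<rho> * (ray k (j + 1) - ray k j) = ray k (j + m)"
proof -
  have *: "\<rho> * ray k (j + 1) = (\<Sum>i=1..j + m. ray k i)"
  \<comment> \<open>In the boundary case the successor of the last (C_j) is the first (E_j).\<close>
  proof (cases "j + m = k")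
    case True
    then show ?thesis using sum_ray_total[of k] ray_eq_1[of k "j + 1"] assms m_ge_2 by simp
  next
    case False
    then show ?thesis using sum_ray_head[of k "j + 1"] assms by simp
  qed
  have "\<rho> * ray k j = (\<Sum>i=1..j + m - 1. ray k i)"
    using sum_ray_head[of k j] assms by simp
  moreover have "(\<Sum>i=1..j + m. ray k i) = (\<Sum>i=1..j + m - 1. ray k i) + ray k (j + m)"
    using m_ge_2 by (cases "j + m") auto
  ultimately show ?thesis using * by (simp add: algebra_simps)
qed

lemma ray_last_bounds:
  assumes "1 \<le> k"
  shows "1 \<le> ray k k" "ray k k \<le> \<rho>"
  using w_end_ge_1[OF assms] w_le_E[of "k + m - 2"] rho_gt_E rho_pos
  by (auto simp: ray_def field_simps)

text \<open>Three ranges occur: first the differences are later coordinates over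
  \<open>\<rho>\<close>, then all coordinates are 1, and the final step goes up because
  \<open>w\<close> stays below \<open>\<rho>\<close>.\<close>

lemma ray_mono:
  assumes "m \<le> k" "1 \<le> i" "i < k"
  shows "ray k i \<le> ray k (i + 1)"
proof -
  consider "i + m \<le> k" | "k - m < i" "i + 1 < k" | "k - m < i" "i + 1 = k"
    using assms by linarith
  then show ?thesis
  proof cases
    case 1
    then have "0 \<le> \<rho> * (ray k (i + 1) - ray k i)"
      using ray_diff[of i k] ray_nonneg[of "i + m" k] assms by simp
    then show ?thesis using rho_pos by (simp add: zero_le_mult_iff)
  next
    case 2
    then show ?thesis by (simp add: ray_eq_1)
  next
    case 3
    then show ?thesis using ray_last_bounds[of k] ray_eq_1[of k i] assms by simp
  qed
qed

lemma ray_first_pos: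
  assumes "m \<le> k"
  shows "0 < ray k 0"
proof -
  have "w (k - 1) < w (k + m - 2)" using assms m_ge_2 by (intro w_strict) auto
  moreover have "0 < w (k + m - 2)" using w_end_ge_1[of k] assms m_ge_2 by simp
  moreover have "0 < g (k + m - 2)" using assms m_ge_2 by (intro g_pos) auto
  ultimately show ?thesis using assms m_ge_2 by (simp add: ray_eq)
qed

section \<open>The line \<open>Delta\<close> consists of the multiples of \<open>ray\<close>\<close>

lemma ray_pt_sum:
  assumes "p \<le> k"
  shows "(\<Sum>i=1..p. ray_pt c k i) = c * (\<Sum>i=1..p. ray k i)"
  unfolding sum_distrib_left by (rule sum.cong) (use assms in \<open>auto simp: ray_pt_def\<close>)

lemma ray_pt_apply: "1 \<le> i \<Longrightarrow> i \<le> k \<Longrightarrow> ray_pt c k i = c * ray k i"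
  by (simp add: ray_pt_def)

lemma ray_pt_in_Delta:
  assumes "m \<le> k"
  shows "ray_pt c k \<in> Delta m \<rho> k"
proof -
  have "(\<Sum>i=1..j + m - 1. ray_pt c k i) = \<rho> * ray_pt c k j" if "j \<in> {1..k - m}" for j
  proof -
    have "1 \<le> j" "j \<le> k" "j + m - 1 \<le> k" "j \<le> k - m" using that assms m_ge_2 by auto
    then show ?thesis
      using sum_ray_head[OF assms, of j] ray_pt_sum[of "j + m - 1" k c] by (simp add: ray_pt_apply)
  qed
  moreover have "(\<Sum>i=1..k. ray_pt c k i) = \<rho> * ray_pt c k j" if "j \<in> {k - m + 1..k - 1}" for j
  proof -
    have "1 \<le> j" "j \<le> k" "k - m < j" "j < k" using that by auto
    then show ?thesis
      using sum_ray_total[of k] ray_pt_sum[of k k c] by (simp add: ray_pt_apply ray_eq_1)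
  qed
  ultimately show ?thesis by (simp add: Delta_def pt_def ray_pt_def)
qed

lemma Delta_recurrence:
  assumes "m \<le> k" "x \<in> Delta m \<rho> k" "1 \<le> j" "j + m \<le> k"
  shows "x j = x (j + 1) - x (j + m) / \<rho>"
proof -
  have C: "(\<Sum>i=1..j + m - 1. x i) = \<rho> * x j" if "1 \<le> j" "j + m \<le> k" for j
    using assms(2) that by (simp add: Delta_def)
  have "(\<Sum>i=1..j + m. x i) = \<rho> * x (j + 1)"
  proof (cases "j + m = k")
    case True
    then have "j + 1 \<in> {k - m + 1..k - 1}" using m_ge_2 by auto
    then show ?thesis using assms(2) True by (simp add: Delta_def)
  next
    case False
    then show ?thesis using C[of "j + 1"] assms by simp
  qed
  moreover have "(\<Sum>i=1..j + m. x i) = (\<Sum>i=1..j + m - 1. x i) + x (j + m)"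
    using m_ge_2 by (cases "j + m") auto
  ultimately have "\<rho> * x (j + 1) = \<rho> * x j + x (j + m)" using C[of j] assms by simp
  then show ?thesis using rho_pos by (simp add: field_simps)
qed

text \<open>Read backwards, the recurrence determines a point from \<open>x (k - 1)\<close> and
  \<open>x k\<close>, and the total sum then ties \<open>x k\<close> to \<open>x (k - 1)\<close>.
  This uniqueness evaluates the definite descriptions of \<open>X0\<close> and
  \<open>XB\<close>.\<close>

lemma Delta_is_ray:
  assumes k: "m \<le> k" and x: "x \<in> Delta m \<rho> k"
  shows "x = ray_pt (x (k - 1)) k"
proof -
  define a b where "a = x (k - 1)" and "b = x k / \<rho>"
  have total: "(\<Sum>i=1..k. x i) = \<rho> * x j" if "k - m < j" "j < k" for j
    using x that by (simp add: Delta_def)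
  have tot: "(\<Sum>i=1..k. x i) = \<rho> * a" using total[of "k - 1"] k m_ge_2 by (simp add: a_def)
  have form: "x (k - n) = a * g (n + m - 2) - b * g (n - 1)" if "1 \<le> n" "n < k" for n
    using that
  proof (induction n rule: less_induct)
    case (less n)
    show ?case
    proof (cases "n < m")
      case True
      have "\<rho> * x (k - n) = \<rho> * a" using total[of "k - n"] tot less.prems True k by simp
      moreover have "g (n + m - 2) = 1"
        using g_eq_1[of "n - 1"] less.prems True by (simp add: numeral_2_eq_2)
      moreover have "g (n - 1) = 0" using True less.prems by (intro g_eq_0) auto
      ultimately show ?thesis using rho_pos by simp
    next
      case False
      have "x (k - n) = x (k - (n - 1)) - x (k - (n - m)) / \<rho>"
        using Delta_recurrence[OF k x, of "k - n"] False less.prems m_ge_2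
        by (simp add: Suc_diff_le)
      also have "x (k - (n - 1)) = a * g (n + m - 3) - b * g (n - 2)"
        using less.IH[of "n - 1"] False less.prems m_ge_2 by (simp add: numeral_eq_Suc)
      \<comment> \<open>For \<open>n = m\<close> the delayed coordinate is \<open>x k\<close>, which
        the induction does not cover. There \<open>- \<rho>\<close> acts as the value of
        \<open>g\<close> at index -1, obtained by running the recurrence back from
        \<open>g (m - 1) = 1\<close>.\<close>
      also have "x (k - (n - m)) / \<rho> = (a * g (n - 2) - b * (if n = m then - \<rho> else g (n - m - 1))) / \<rho>"
      proof (cases "n = m")
        case True
        then show ?thesis using rho_pos m_ge_2 by (simp add: b_def g_eq_0)
      next
        case neq: False
        then show ?thesis using less.IH[of "n - m"] False less.prems m_ge_2 by simp
      qed
      finally have *: "x (k - n) = a * g (n + m - 3) - b * g (n - 2)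
          - (a * g (n - 2) - b * (if n = m then - \<rho> else g (n - m - 1))) / \<rho>" .
      have "g (n + m - 2) = g (n + m - 3) - g (n - 2) / \<rho>"
        using g_rec[of "n + m - 2"] False m_ge_2 by (simp add: numeral_eq_Suc)
      moreover have "g (n - 1) = g (n - 2) - (if n = m then - \<rho> else g (n - m - 1)) / \<rho>"
      proof (cases "n = m")
        case True
        then show ?thesis using rho_pos m_ge_2 by (simp add: g_eq_1_first g_eq_0)
      next
        case neq: False
        then show ?thesis using g_rec[of "n - 1"] False m_ge_2
          by (simp add: numeral_eq_Suc diff_commute)
      qed
      ultimately show ?thesis unfolding * by (simp only: diff_divide_distrib)
          (simp add: right_diff_distrib)
    qed
  qed
  have k1: "1 \<le> k" using k m_ge_2 by simp
  \<comment> \<open>The total is this telescoped sum plus \<open>\<rho> * b\<close>, and it also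
    equals \<open>\<rho> * a\<close>; equating both leaves one free parameter.\<close>
  have "(\<Sum>i=1..k - 1. x i) = \<rho> * (a * (g (k - (k - 1) + 2 * m - 3) - g (k + 2 * m - 3))
                                - b * (g (k - (k - 1) + m - 2) - g (k + m - 2)))"
  proof (rule partial_sum)
    show "x i = a * g (k - i + m - 2) - b * g (k - i - 1)" if "1 \<le> i" "i < k" for i
      using form[of "k - i"] that by simp
  qed (use k1 in auto)
  moreover have "k - (k - 1) + 2 * m - 3 = 2 * m - 2" "k - (k - 1) + m - 2 = m - Suc 0"
    using k1 m_ge_2 by auto
  ultimately have "(\<Sum>i=1..k - 1. x i)
      = \<rho> * (a * (1 - g (k + 2 * m - 3)) - b * (1 - g (k + m - 2)))"
    by (simp only: g_double g_eq_1_first)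
  moreover have "(\<Sum>i=1..k. x i) = (\<Sum>i=1..k - 1. x i) + \<rho> * b"
    using k1 rho_pos by (cases k) (auto simp: b_def)
  ultimately have "\<rho> * a = \<rho> * (a * (1 - g (k + 2 * m - 3)) - b * (1 - g (k + m - 2))) + \<rho> * b"
    using tot by metis
  then have "\<rho> * (b * g (k + m - 2)) = \<rho> * (a * g (k + 2 * m - 3))"
    by (simp add: right_diff_distrib)
  then have "b * w (k + m - 2) * g (k + 2 * m - 3) = a * g (k + 2 * m - 3)"
    using rho_pos g_eq_w_mult_end[OF k1] by simp
  moreover have "0 < g (k + 2 * m - 3)" using k1 m_ge_2 by (intro g_pos) auto
  ultimately have b: "b = a / w (k + m - 2)"
    using w_end_ge_1[OF k1] by (simp add: field_simps)
  show ?thesis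
  proof
    fix i
    consider "i \<notin> {1..k}" | "i = k" | "1 \<le> i" "i < k" by force
    then show "x i = ray_pt (x (k - 1)) k i"
    proof cases
      case 1
      then show ?thesis using x
        by (auto simp: Delta_def pt_def ray_pt_def restrict_def PiE_def extensional_def)
    next
      case 2
      have "x k = \<rho> * b" using rho_pos by (simp add: b_def)
      then show ?thesis using 2 k1 unfolding a_def[symmetric]
        by (simp add: ray_pt_apply ray_def b)
    next
      case 3
      then show ?thesis using form[of "k - i"] unfolding a_def[symmetric]
        by (simp add: ray_pt_apply ray_def b algebra_simps)
    qed
  qed
qed

lemma ray_pt_C0: "m \<le> k \<Longrightarrow> (\<Sum>i=1..m - 1. ray_pt c k i) = c * ray k 0 * \<rho>"
  using ray_pt_sum[of "m - 1" k c] sum_ray_head[of k 0] by simp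

lemma ray_pt_B:
  assumes "1 \<le> k"
  shows "2 * (\<Sum>i=1..k - 1. ray_pt c k i) + ray_pt c k k = c * (2 * \<rho> - ray k k)"
proof -
  have "(\<Sum>i=1..k. ray k i) = (\<Sum>i=1..k - 1. ray k i) + ray k k"
    using assms by (cases k) auto
  then have head: "(\<Sum>i=1..k - 1. ray k i) = \<rho> - ray k k"
    using sum_ray_total[OF assms] by simp
  have "(\<Sum>i=1..k - 1. ray_pt c k i) = c * (\<rho> - ray k k)"
    unfolding head[symmetric] by (rule ray_pt_sum) simp
  moreover have "ray_pt c k k = c * ray k k" using assms by (simp add: ray_pt_apply)
  ultimately show ?thesis by (simp only:) (simp add: algebra_simps)
qed

lemma budget_coeff_pos: "1 \<le> k \<Longrightarrow> \<rho> \<le> 2 * \<rho> - ray k k"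
  using ray_last_bounds[of k] by simp

section \<open>Feasibility and objective values of the two points\<close>

lemma X0_eq:
  assumes "m \<le> k"
  shows "X0 m \<rho> k = ray_pt (1 / ray k 0) k"
  unfolding X0_def
proof (rule the_equality)
  show "ray_pt (1 / ray k 0) k \<in> Delta m \<rho> k \<and> (\<Sum>i=1..m - 1. ray_pt (1 / ray k 0) k i) = \<rho>"
    using ray_pt_in_Delta[OF assms] ray_pt_C0[OF assms] ray_first_pos[OF assms] by simp
  fix x assume x: "x \<in> Delta m \<rho> k \<and> (\<Sum>i=1..m - 1. x i) = \<rho>"
  define c where "c = x (k - 1)"
  have eq: "x = ray_pt c k" using Delta_is_ray[OF assms] x by (simp add: c_def)
  have "c * ray k 0 * \<rho> = \<rho>" using x ray_pt_C0[OF assms, of c] unfolding eq by simp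
  then have "c = 1 / ray k 0" using rho_pos ray_first_pos[OF assms] by (simp add: field_simps)
  then show "x = ray_pt (1 / ray k 0) k" using eq by simp
qed

lemma XB_eq:
  assumes "m \<le> k"
  shows "XB m \<rho> T k = ray_pt (T / (2 * \<rho> - ray k k)) k"
  unfolding XB_def
proof (rule the_equality)
  have k1: "1 \<le> k" using assms m_ge_2 by simp
  have pos: "0 < 2 * \<rho> - ray k k" using budget_coeff_pos[OF k1] rho_pos by linarith
  let ?c = "T / (2 * \<rho> - ray k k)"
  show "ray_pt ?c k \<in> Delta m \<rho> k \<and> 2 * (\<Sum>i=1..k - 1. ray_pt ?c k i) + ray_pt ?c k k = T"
    using ray_pt_in_Delta[OF assms] ray_pt_B[OF k1, of ?c] pos by simp
  fix x assume x: "x \<in> Delta m \<rho> k \<and> 2 * (\<Sum>i=1..k - 1. x i) + x k = T"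
  define c where "c = x (k - 1)"
  have eq: "x = ray_pt c k" using Delta_is_ray[OF assms] x by (simp add: c_def)
  have "c * (2 * \<rho> - ray k k) = T" using x ray_pt_B[OF k1, of c] unfolding eq by simp
  then have "c = ?c" using pos by (simp add: field_simps)
  then show "x = ray_pt ?c k" using eq by simp
qed

text \<open>On the line (C_j) and (E_j) are tight, and (M_i) follows from \<open>ray_mono\<close>
  since \<open>c\<close> is nonnegative; only (C0) and (B) remain.\<close>

lemma ray_pt_feasible_iff:
  assumes "m \<le> k" "0 \<le> c"
  shows "ray_pt c k \<in> feasible m \<rho> T k \<longleftrightarrow> c * ray k 0 \<le> 1 \<and> c * (2 * \<rho> - ray k k) \<le> T"
proof -
  have k1: "1 \<le> k" using assms m_ge_2 by simp
  have "ray_pt c k i \<le> ray_pt c k (i + 1)" if "i \<in> {1..k - 1}" for i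
    using that ray_mono[OF assms(1), of i] assms k1
    by (auto simp: ray_pt_apply intro!: mult_left_mono)
  moreover have "c * ray k 0 * \<rho> \<le> \<rho> \<longleftrightarrow> c * ray k 0 \<le> 1"
    using rho_pos by (simp add: mult_le_cancel_right1)
  ultimately show ?thesis
    using ray_pt_in_Delta[OF assms(1), of c]
    unfolding feasible_def Delta_def mem_Collect_eq ray_pt_C0[OF assms(1)] ray_pt_B[OF k1]
    by auto
qed

lemma objective_ray_pt:
  assumes "m \<le> k"
  shows "objective m (k, ray_pt c k) = c * (ray k k + (real m - 1))"
proof -
  have "(\<Sum>i=0..m - 1. ray_pt c k (k - i)) = ray_pt c k k + (\<Sum>i=1..m - 1. ray_pt c k (k - i))"
    by (simp add: sum.atLeast_Suc_atMost)
  also have "(\<Sum>i=1..m - 1. ray_pt c k (k - i)) = (\<Sum>i=1..m - 1. c)"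
    using assms m_ge_2 by (intro sum.cong) (auto simp: ray_pt_apply ray_eq_1)
  also have "\<dots> = c * (real m - 1)" using m_ge_2 by (simp add: of_nat_diff)
  finally show ?thesis using assms m_ge_2 by (simp add: ray_pt_apply algebra_simps)
qed

lemma X0_feasible_iff:
  assumes "m \<le> k"
  shows "X0 m \<rho> k \<in> feasible m \<rho> T k \<longleftrightarrow> 2 * \<rho> - ray k k \<le> T * ray k 0"
  using ray_first_pos[OF assms] ray_pt_feasible_iff[OF assms, of "1 / ray k 0" T]
  by (simp add: X0_eq[OF assms] pos_divide_le_eq)

lemma XB_feasible_iff:
  assumes "m \<le> k" "0 < T"
  shows "XB m \<rho> T k \<in> feasible m \<rho> T k \<longleftrightarrow> T * ray k 0 \<le> 2 * \<rho> - ray k k"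
proof -
  have "1 \<le> k" using assms m_ge_2 by simp
  then have "0 < 2 * \<rho> - ray k k" using budget_coeff_pos rho_pos by fastforce
  then show ?thesis using ray_pt_feasible_iff[OF assms(1), of "T / (2 * \<rho> - ray k k)" T] assms
    by (simp add: XB_eq[OF assms(1)] pos_divide_le_eq)
qed

section \<open>Monotonicity in the dimension\<close>

lemma ray_last_antimono:
  assumes "1 \<le> k" "k \<le> l"
  shows "ray l l \<le> ray k k"
proof -
  have "w (k + m - 2) \<le> w (l + m - 2)" using assms by (intro w_mono) auto
  then show ?thesis using w_end_ge_1[of k] assms rho_pos
    by (auto simp: ray_def intro!: divide_left_mono)
qed

text \<open>The entries involved at \<open>k\<close> and \<open>Suc k\<close> are expressed by
  \<open>\<rho>\<close>, one value \<open>h\<close> of \<open>g\<close> and three values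
  \<open>a\<close>, \<open>b\<close>, \<open>c\<close> of \<open>w\<close> at distance
  \<open>m - 1\<close>. The first claim then reduces to \<open>B \<le> A\<close>, the second to
  \<open>D \<le> c - b\<close>.\<close>

lemma ray_step:
  assumes "m \<le> k"
  shows "ray (Suc k) 0 \<le> ray k 0"
    and "ray k k / ray k 0 \<le> ray (Suc k) (Suc k) / ray (Suc k) 0"
proof -
  define j where "j = k - 1"
  have j: "k = Suc j" "m - 1 \<le> j" using assms m_ge_2 by (auto simp: j_def)
  define a b c where "a = w (Suc j - m)" and "b = w j" and "c = w (j + m - 1)"
  define A B C where "A = 1 - a / \<rho>" and "B = 1 - b / \<rho>" and "C = 1 - c / \<rho>"
  define h where "h = g (j + m - 1)"
  have pos: "0 < A" "0 < B" "0 < C" "0 < h" "1 \<le> b" "b < c" "a \<le> b"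
    using ratio_pos g_shift_pos[of j] w_ge_1[OF j(2)] w_strict[of j "j + m - 1"] j m_ge_2
      w_mono[of "Suc j - m" j]
    by (auto simp: A_def B_def C_def a_def b_def c_def h_def)
  have b': "w (Suc j) = b * A / B"
    using w_Suc[OF j(2)] pos unfolding A_def[symmetric] B_def[symmetric] a_def[symmetric] b_def[symmetric]
    by (simp add: eq_divide_eq)
  have "Suc (j + m - 1) - m = j" "Suc (j + m - 1) = j + m" "m - 1 \<le> j + m - 1"
    using m_ge_2 by auto
  then have "w (j + m) * C = c * B"
    using w_Suc[of "j + m - 1"] unfolding C_def c_def B_def b_def by simp
  then have c': "w (j + m) = c * B / C" using pos by (simp add: eq_divide_eq)
  have h': "g (j + m) = h * B" using g_step[of j] by (simp add: h_def B_def b_def)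
  have idx: "k + m - 2 = j + m - 1" "Suc k + m - 2 = j + m" using j m_ge_2 by auto
  have q: "ray k 0 = h * (1 - b / c)"
    using ray_eq[of 0 k] j idx by (simp add: h_def b_def c_def)
  have q': "ray (Suc k) 0 = h * B * (1 - (b * A / B) / (c * B / C))"
    using ray_eq[of 0 "Suc k"] j idx by (simp add: h' b' c')
  have v: "ray k k = \<rho> / c" "ray (Suc k) (Suc k) = \<rho> / (c * B / C)"
    using idx by (simp_all add: ray_def c_def c')
  have "B \<le> A" using pos rho_pos by (simp add: A_def B_def divide_right_mono)
  have cC: "c = \<rho> * (1 - C)" using rho_pos by (simp add: C_def)
  have "ray k 0 - ray (Suc k) 0 = h * (b / c) * (C / B) * (A - B)"
  proof -
    have "ray k 0 - ray (Suc k) 0 = h * (1 - B - b / c + b * A * C / (B * c))"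
      using pos by (simp add: q q' field_simps)
    also have "1 - B = b / c * (1 - C)" using pos by (simp add: B_def C_def)
    finally show ?thesis using pos by (simp add: field_simps)
  qed
  also have "0 \<le> \<dots>" using pos \<open>B \<le> A\<close> by simp
  finally show "ray (Suc k) 0 \<le> ray k 0" by simp
  have key: "(c - b)\<^sup>2 \<le> (b - a) * b * C"
    using w_increment_square_le[OF j(2)] by (simp add: a_def b_def c_def C_def)
  \<comment> \<open>\<open>D\<close> is to \<open>Suc k\<close> what \<open>c - b\<close> is to
    \<open>k\<close>: the two quotients are \<open>\<rho> / (h * D)\<close> and
    \<open>\<rho> / (h * (c - b))\<close>.\<close>
  define D where "D = B * (c * B / C - b * A / B)"
  have "D = (c * B\<^sup>2 - b * A * C) / C"
    using pos by (simp add: D_def field_simps power2_eq_square)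
  also have "\<dots> \<le> c - b"
  proof -
    \<comment> \<open>Up to positive factors, the gap in the bound on \<open>D\<close> is the gap in
      \<open>key\<close>.\<close>
    have "\<rho> * (C * (c - b) - (c * B\<^sup>2 - b * A * C)) = (b - a) * b * C - (c - b)\<^sup>2"
    proof -
      have "b = \<rho> * (1 - B)" "a = \<rho> * (1 - A)" using rho_pos by (auto simp: A_def B_def)
      with cC show ?thesis by (simp only:) (simp add: algebra_simps power2_eq_square)
    qed
    with key have "0 \<le> \<rho> * (C * (c - b) - (c * B\<^sup>2 - b * A * C))" by simp
    then have "c * B\<^sup>2 - b * A * C \<le> C * (c - b)" using rho_pos by (simp add: zero_le_mult_iff)
    then show ?thesis using pos by (simp add: pos_divide_le_eq mult.commute)
  qed
  finally have "D \<le> c - b" .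
  have q'2: "ray (Suc k) 0 = h * D / (c * B / C)"
    using pos by (simp add: q' D_def field_simps)
  have "0 < ray (Suc k) 0" using ray_first_pos[of "Suc k"] assms by simp
  moreover have "0 < c * B / C" using pos by (intro divide_pos_pos mult_pos_pos) auto
  ultimately have "0 < h * D" unfolding q'2 by (metis zero_less_divide_iff less_asym)
  then have "0 < D" using pos by (simp add: zero_less_mult_iff)
  have "ray k k / ray k 0 = \<rho> / (h * (c - b))"
    using pos by (simp add: v q field_simps)
  also have "\<dots> \<le> \<rho> / (h * D)"
    using \<open>D \<le> c - b\<close> \<open>0 < D\<close> pos rho_pos by (intro divide_left_mono mult_left_mono) auto
  also have "\<dots> = ray (Suc k) (Suc k) / ray (Suc k) 0"
    unfolding q'2 v using pos \<open>0 < D\<close> by (simp add: field_simps)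
  finally show "ray k k / ray k 0 \<le> ray (Suc k) (Suc k) / ray (Suc k) 0" .
qed

lemma ray_first_antimono:
  assumes "m \<le> k" "k \<le> l"
  shows "ray l 0 \<le> ray k 0"
  using assms(2)
proof (induction l rule: dec_induct)
  case (step n)
  then show ?case using ray_step(1)[of n] assms by simp
qed simp

lemma ray_quotient_mono:
  assumes "m \<le> k" "k \<le> l"
  shows "ray k k / ray k 0 \<le> ray l l / ray l 0"
  using assms(2)
proof (induction l rule: dec_induct)
  case (step n)
  then show ?case using ray_step(2)[of n] assms by simp
qed simp

lemma objective_X0_mono:
  assumes "m \<le> k" "k \<le> l"
  shows "objective m (k, X0 m \<rho> k) \<le> objective m (l, X0 m \<rho> l)"
proof -
  have l: "m \<le> l" using assms by simp
  have "(real m - 1) / ray k 0 \<le> (real m - 1) / ray l 0"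
    using ray_first_antimono[OF assms] ray_first_pos[OF assms(1)] ray_first_pos[OF l] m_ge_2
    by (intro divide_left_mono) auto
  with ray_quotient_mono[OF assms]
  have "(ray k k + (real m - 1)) / ray k 0 \<le> (ray l l + (real m - 1)) / ray l 0"
    by (simp only: add_divide_distrib add_mono)
  then show ?thesis
    by (simp only: X0_eq[OF assms(1)] X0_eq[OF l] objective_ray_pt[OF assms(1)]
        objective_ray_pt[OF l] times_divide_eq_left mult_1)
qed

lemma objective_XB_antimono:
  assumes "m \<le> k" "k \<le> l" "0 < T"
  shows "objective m (l, XB m \<rho> T l) \<le> objective m (k, XB m \<rho> T k)"
proof -
  have l: "m \<le> l" and k1: "1 \<le> k" "1 \<le> l" using assms m_ge_2 by auto
  have v: "ray l l \<le> ray k k" using ray_last_antimono k1 assms by simp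
  have pos: "0 < 2 * \<rho> - ray k k" using budget_coeff_pos[of k] k1 rho_pos by simp
  have "T / (2 * \<rho> - ray l l) * (ray l l + (real m - 1))
      \<le> T / (2 * \<rho> - ray k k) * (ray k k + (real m - 1))"
    using v pos assms m_ge_2 ray_last_bounds(1)[of l] k1
    by (intro mult_mono divide_left_mono) auto
  then show ?thesis
    by (simp only: XB_eq[OF assms(1)] XB_eq[OF l] objective_ray_pt[OF assms(1)]
        objective_ray_pt[OF l])
qed

section \<open>Behaviour for large \<open>k\<close> and existence of the thresholds\<close>

text \<open>From \<open>n = m - 1\<close> on \<open>w n\<close> is at least 1, so each step costs at
  least the factor \<open>1 - 1 / \<rho>\<close>. Truncated subtraction gives exponent 0 on the
  initial block, where the value is 1.\<close>

lemma g_geometric: "g (n + m - 1) \<le> (1 - 1 / \<rho>) ^ (n - (m - 1))"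
proof (induction n)
  case 0
  then show ?case by (simp add: g_eq_1_first)
next
  case (Suc n)
  show ?case
  proof (cases "n < m - 1")
    case True
    then show ?thesis using g_eq_1[of "Suc n"] by simp
  next
    case False
    have "g (Suc n + m - 1) = g (n + m - 1) * (1 - w n / \<rho>)" using g_step[of n] by simp
    also have "\<dots> \<le> (1 - 1 / \<rho>) ^ (n - (m - 1)) * (1 - 1 / \<rho>)"
      using Suc w_ge_1[of n] False ratio_pos[of n] rho_pos rho_gt_E E_ge_1
      by (intro mult_mono) (auto simp: divide_right_mono)
    also have "\<dots> = (1 - 1 / \<rho>) ^ (Suc n - (m - 1))" using False by (simp add: Suc_diff_le)
    finally show ?thesis .
  qed
qed

text \<open>Since \<open>ray k k \<le> \<rho>\<close>, it suffices that \<open>T * ray k 0\<close>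
  drops below \<open>\<rho>\<close>. The strict inequality excludes \<open>X0\<close> and admits
  \<open>XB\<close> for all large \<open>k\<close>, so it serves both thresholds.\<close>

lemma eventually_budget_slack:
  assumes "0 < T"
  shows "\<exists>N. \<forall>k\<ge>N. m \<le> k \<and> T * ray k 0 < 2 * \<rho> - ray k k"
proof -
  have "0 \<le> 1 - 1 / \<rho>" "1 - 1 / \<rho> < 1" using rho_gt_E E_ge_1 by auto
  then obtain e where e: "(1 - 1 / \<rho>) ^ e < \<rho> / T"
    using real_arch_pow_inv[of "\<rho> / T" "1 - 1 / \<rho>"] rho_pos assms by auto
  \<comment> \<open>The shift by \<open>m\<close> makes the exponent of \<open>g_geometric\<close>
    at \<open>k - 1\<close> equal to \<open>e\<close>.\<close>
  define k where "k = e + m"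
  have k: "m \<le> k" "1 \<le> k" using m_ge_2 by (auto simp: k_def)
  have "w (k - 1) / w (k + m - 2) \<ge> 0" using w_nonneg by simp
  then have "ray k 0 \<le> g (k - 1 + m - 1)"
    using ray_eq[of 0 k] k g_nonneg[of "k + m - 2"] m_ge_2
    by (simp add: mult_left_le numeral_2_eq_2)
  also have "\<dots> \<le> (1 - 1 / \<rho>) ^ e" using g_geometric[of "k - 1"] m_ge_2
    by (auto simp: k_def)
  finally have q: "T * ray k 0 < \<rho>" using e assms by (simp add: pos_less_divide_eq mult.commute)
      (smt (verit) mult_left_mono mult.commute)
  have "m \<le> l \<and> T * ray l 0 < 2 * \<rho> - ray l l" if "k \<le> l" for l
  proof -
    have "T * ray l 0 \<le> T * ray k 0"
      using ray_first_antimono[OF k(1) that] assms by (intro mult_left_mono) auto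
    then show ?thesis using q budget_coeff_pos[of l] that k by simp
  qed
  then show ?thesis by blast
qed

text \<open>Both \<open>T * ray k 0\<close> and \<open>ray k k\<close> decrease in \<open>k\<close>,
  so the inequality for \<open>X0\<close> passes to smaller \<open>k\<close> and the reverse one for
  \<open>XB\<close> to larger \<open>k\<close>.\<close>

lemma feasible_threshold:
  assumes "m \<le> k" "k \<le> l" "0 < T"
  shows X0_feasible_downward: "X0 m \<rho> l \<in> feasible m \<rho> T l \<Longrightarrow> X0 m \<rho> k \<in> feasible m \<rho> T k"
    and XB_feasible_upward: "XB m \<rho> T k \<in> feasible m \<rho> T k \<Longrightarrow> XB m \<rho> T l \<in> feasible m \<rho> T l"
proof -
  have q: "T * ray l 0 \<le> T * ray k 0"
    using ray_first_antimono[OF assms(1,2)] assms by (intro mult_left_mono) auto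
  have v: "ray l l \<le> ray k k" using ray_last_antimono assms m_ge_2 by simp
  have l: "m \<le> l" using assms by simp
  show "X0 m \<rho> k \<in> feasible m \<rho> T k" if "X0 m \<rho> l \<in> feasible m \<rho> T l"
    using that q v unfolding X0_feasible_iff[OF assms(1)] X0_feasible_iff[OF l] by linarith
  show "XB m \<rho> T l \<in> feasible m \<rho> T l" if "XB m \<rho> T k \<in> feasible m \<rho> T k"
    using that q v
    unfolding XB_feasible_iff[OF assms(1,3)] XB_feasible_iff[OF l assms(3)] by linarith
qed

lemma is_k0_exists:
  assumes "0 < T" "m \<le> k" "X0 m \<rho> k \<in> feasible m \<rho> T k"
  shows "\<exists>k0. is_k0 m \<rho> T k0"
proof -
  let ?P = "\<lambda>k. m \<le> k \<and> X0 m \<rho> k \<in> feasible m \<rho> T k"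
  obtain N where N: "\<forall>k\<ge>N. m \<le> k \<and> T * ray k 0 < 2 * \<rho> - ray k k"
    using eventually_budget_slack[OF assms(1)] by blast
  have bound: "\<forall>l. ?P l \<longrightarrow> l \<le> N"
    using N X0_feasible_iff[of _ T] by (meson nle_le not_less)
  have "?P (GREATEST k. ?P k)" using GreatestI_nat[of ?P k N] bound assms by blast
  moreover have "l \<le> (GREATEST k. ?P k)" if "?P l" for l
    using Greatest_le_nat[of ?P l N] bound that by blast
  ultimately show ?thesis unfolding is_k0_def by blast
qed

lemma is_kB_exists:
  assumes "0 < T"
  shows "\<exists>kB. is_kB m \<rho> T kB"
proof -
  let ?P = "\<lambda>k. m \<le> k \<and> XB m \<rho> T k \<in> feasible m \<rho> T k"
  obtain N where "\<forall>k\<ge>N. m \<le> k \<and> T * ray k 0 < 2 * \<rho> - ray k k"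
    using eventually_budget_slack[OF assms] by blast
  then have "?P N" using XB_feasible_iff[of N T] assms by auto
  then have "?P (LEAST k. ?P k)" by (rule LeastI)
  moreover have "(LEAST k. ?P k) \<le> l" if "?P l" for l using that by (rule Least_le)
  ultimately show ?thesis unfolding is_kB_def by blast
qed

end

theorem theorem2:
  fixes m :: nat and \<rho> T :: real
  assumes "m \<ge> 2"
    and "\<rho> \<ge> real m ^ m / real (m - 1) ^ (m - 1)"
    and "T > 0"
  shows
    "((\<exists>k\<ge>m. X0 m \<rho> k \<in> feasible m \<rho> T k) \<longrightarrow> (\<exists>k0. is_k0 m \<rho> T k0)) \<and>
     (\<exists>kB. is_kB m \<rho> T kB) \<and>
     (\<forall>k0. is_k0 m \<rho> T k0 \<longrightarrow>
        (\<forall>k\<ge>m. X0 m \<rho> k \<in> feasible m \<rho> T k \<longleftrightarrow> k \<le> k0) \<and>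
        optimal_for m (k0, X0 m \<rho> k0) (set_X0 m \<rho> T)) \<and>
     (\<forall>kB. is_kB m \<rho> T kB \<longrightarrow>
        (\<forall>k\<ge>m. XB m \<rho> T k \<in> feasible m \<rho> T k \<longleftrightarrow> k \<ge> kB) \<and>
        optimal_for m (kB, XB m \<rho> T kB) (set_XB m \<rho> T))"
proof -
  interpret cyclic_search m \<rho> using assms by unfold_locales
  have X0_iff: "\<forall>k\<ge>m. X0 m \<rho> k \<in> feasible m \<rho> T k \<longleftrightarrow> k \<le> k0" if "is_k0 m \<rho> T k0" for k0
    using that X0_feasible_downward[OF _ _ assms(3)] unfolding is_k0_def by blast
  have XB_iff: "\<forall>k\<ge>m. XB m \<rho> T k \<in> feasible m \<rho> T k \<longleftrightarrow> k \<ge> kB" if "is_kB m \<rho> T kB" for kB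
    using that XB_feasible_upward[OF _ _ assms(3)] unfolding is_kB_def by blast
  have X0_opt: "optimal_for m (k0, X0 m \<rho> k0) (set_X0 m \<rho> T)" if "is_k0 m \<rho> T k0" for k0
    unfolding optimal_for_def
  proof (intro conjI ballI)
    show "(k0, X0 m \<rho> k0) \<in> set_X0 m \<rho> T" using that by (simp add: is_k0_def set_X0_def)
    fix q assume "q \<in> set_X0 m \<rho> T"
    then obtain k where "q = (k, X0 m \<rho> k)" "m \<le> k" "X0 m \<rho> k \<in> feasible m \<rho> T k"
      unfolding set_X0_def by blast
    then show "objective m q \<le> objective m (k0, X0 m \<rho> k0)"
      using objective_X0_mono X0_iff[OF that] by blast
  qed
  have XB_opt: "optimal_for m (kB, XB m \<rho> T kB) (set_XB m \<rho> T)" if "is_kB m \<rho> T kB" for kB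
    unfolding optimal_for_def
  proof (intro conjI ballI)
    show "(kB, XB m \<rho> T kB) \<in> set_XB m \<rho> T" using that by (simp add: is_kB_def set_XB_def)
    fix q assume "q \<in> set_XB m \<rho> T"
    then obtain k where "q = (k, XB m \<rho> T k)" "m \<le> k" "XB m \<rho> T k \<in> feasible m \<rho> T k"
      unfolding set_XB_def by blast
    then show "objective m q \<le> objective m (kB, XB m \<rho> T kB)"
      using objective_XB_antimono XB_iff[OF that] that assms(3) unfolding is_kB_def by blast
  qed
  show ?thesis
    using is_k0_exists is_kB_exists assms(3) X0_iff XB_iff X0_opt XB_opt by blast
qed

end
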